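(* Let $n\ge 8$ be an integer, let $W_n$ be the wheel graph on $n$ vertices with hub $h$, and let $H_n$ be the helm graph obtained from $W_n$ by attaching a pendant edge to each rim vertex. Then the visibility polynomial of $H_n$ is $$\mathcal{V}(H_n)= \mathcal{V}(W_n)+\left((1+x)^{n-1}-1\right)+(n-1)x^2+\sum_Q w_Q(x),$$ where the sum runs over all nonempty mutual-visibility sets $Q\subsetneq V(W_n)$ of $W_n$ and, with $\overline{Q}=V(W_n)\setminus Q$, $$w_Q(x)=\begin{cases}\left((1+x)^{|\overline{Q}|-1}\right)x^{|Q|} & \text{if } h\notin Q,\\[4pt] p_Q(x) & \text{otherwise.}\end{cases}$$ Here $$p_Q(x)=\begin{cases}\displaystyle\sum_{\Omega\in\Gamma_Q(W_n)}\left((1+x)^{|\Omega|}-1\right)x^{|Q|} & \text{if } Q \text{ is disjoint-visible},\\[10pt] \displaystyle\sum_{\emptyset\ne\mathcal{J}\subseteq\Gamma_Q(W_n)}(-1)^{|\mathcal{J}|+1}\left((1+x)^{\left|\bigcap_{W\in\mathcal{J}}W\right|}-1\right)x^{|Q|} & \text{otherwise,}\end{cases}$$ where $\Gamma_Q(W_n)$ is the collection of all maximal absolute $c_Q$-visible sets of $W_n$.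
   Context: Graphs are finite, simple, undirected and connected. For $X\subseteq V(G)$, two vertices $u,v\in V(G)$ are $X$-visible if there is a shortest $(u,v)$-path $P$ in $G$ with $V(P)\cap X\subseteq\{u,v\}$. A set $A\subseteq V(G)$ is $X$-visible if every pair of vertices of $A$ is $X$-visible; $X$ is a mutual-visibility set of $G$ if $X$ is $X$-visible (in particular the empty set and singletons are mutual-visibility sets). The visibility polynomial of $G$ is $\mathcal{V}(G)=\sum_{i\ge 0} r_i x^i$, where $r_i$ is the number of mutual-visibility sets of $G$ of cardinality $i$ (so $r_0=1$). The wheel graph $W_n=C_{n-1}\vee K_1$ (join) has $n$ vertices: the hub $h$ (the vertex of $K_1$), adjacent to every vertex of the cycle $C_{n-1}$ (the rim). The helm graph $H_n$ is obtained from $W_n$ by attaching one new pendant vertex to each of the $n-1$ rim vertices (and none to the hub); it has $2n-1$ vertices. For $Q\subseteq V(G)$ and $\overline{Q}=V(G)\setminus Q$, a set $W\subseteq\overline{Q}$ is a $c_Q$-visible set of $G$ if $W$ is $Q$-visible and $\{u,w\}$ is $Q$-visible for all $u\in Q$, $w\in W$. It is an absolute $c_Q$-visible set if moreover $Q$ is a mutual-visibility set of $G$ (equivalently, $Q\cup W$ is $Q$-visible). It is maximal if it is not properly contained in a larger such set. $\Gamma_Q(G)$ is the collection of all maximal absolute $c_Q$-visible sets of $G$. $Q$ is called disjoint-visible if the members of $\Gamma_Q(G)$ are pairwise disjoint.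
   Formalization: For h not in Q the summand is corrected to ((1+x)^{|Q̄|-1} - 1)x^{|Q|}; as printed, without the "-1", the identity fails already at the coefficient of x (3n-2 on the right against 2n-1 on the left). *)

theory Defs
  imports "Graph_Theory.Graph_Theory" "HOL-Computational_Algebra.Polynomial"
begin

text \<open>
  A simple undirected graph is an instance of locale \<^locale>\<open>pair_graph\<close>: a finite vertex set together
  with an irreflexive symmetric arc relation, every edge being the pair of its two opposite arcs.
\<close>

section \<open>Mutual visibility\<close>

definition shortest_path :: "'a pair_pre_digraph \<Rightarrow> 'a \<Rightarrow> 'a \<Rightarrow> 'a list \<Rightarrow> bool" where
  "shortest_path G u v p \<longleftrightarrow>
     vpath p G \<and> hd p = u \<and> last p = v \<and>
     (\<forall>q. vpath q G \<and> hd q = u \<and> last q = v \<longrightarrow> vwalk_length p \<le> vwalk_length q)"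

definition visible_pair :: "'a pair_pre_digraph \<Rightarrow> 'a set \<Rightarrow> 'a \<Rightarrow> 'a \<Rightarrow> bool" where
  "visible_pair G X u v \<longleftrightarrow> (\<exists>p. shortest_path G u v p \<and> set p \<inter> X \<subseteq> {u, v})"

definition visible_set :: "'a pair_pre_digraph \<Rightarrow> 'a set \<Rightarrow> 'a set \<Rightarrow> bool" where
  "visible_set G X A \<longleftrightarrow> A \<subseteq> pverts G \<and> (\<forall>u\<in>A. \<forall>v\<in>A. visible_pair G X u v)"

definition mutual_visibility_set :: "'a pair_pre_digraph \<Rightarrow> 'a set \<Rightarrow> bool" where
  "mutual_visibility_set G X \<longleftrightarrow> visible_set G X X"

definition visibility_poly :: "'a pair_pre_digraph \<Rightarrow> int poly" where
  "visibility_poly G =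
     (\<Sum>i\<le>card (pverts G). monom (int (card {X. mutual_visibility_set G X \<and> card X = i})) i)"

definition c_visible_set :: "'a pair_pre_digraph \<Rightarrow> 'a set \<Rightarrow> 'a set \<Rightarrow> bool" where
  "c_visible_set G Q W \<longleftrightarrow>
     W \<subseteq> pverts G - Q \<and> visible_set G Q W \<and> (\<forall>u\<in>Q. \<forall>w\<in>W. visible_set G Q {u, w})"

definition abs_c_visible_set :: "'a pair_pre_digraph \<Rightarrow> 'a set \<Rightarrow> 'a set \<Rightarrow> bool" where
  "abs_c_visible_set G Q W \<longleftrightarrow> c_visible_set G Q W \<and> mutual_visibility_set G Q"

definition max_abs_c_visible_sets :: "'a pair_pre_digraph \<Rightarrow> 'a set \<Rightarrow> 'a set set" where
  "max_abs_c_visible_sets G Q =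
     {W. abs_c_visible_set G Q W \<and> \<not> (\<exists>W'. abs_c_visible_set G Q W' \<and> W \<subset> W')}"

definition disjoint_visible :: "'a pair_pre_digraph \<Rightarrow> 'a set \<Rightarrow> bool" where
  "disjoint_visible G Q \<longleftrightarrow> pairwise disjnt (max_abs_c_visible_sets G Q)"

section \<open>Wheel and helm graphs\<close>

datatype helm_vertex = Hub | Rim nat | Pendant nat

text \<open>
  The wheel with \<open>n\<close> vertices has rim \<open>Rim 0, \<dots>, Rim (n - 2)\<close>; the helm hangs \<open>Pendant i\<close> on \<open>Rim i\<close>.
  For \<open>n \<ge> 4\<close> both are simple graphs (for \<open>n = 2\<close> the rim would carry a loop).
\<close>

definition wheel_edges :: "nat \<Rightarrow> helm_vertex rel" where
  "wheel_edges n =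
     {(Hub, Rim i) | i. i < n - 1} \<union> {(Rim i, Rim (Suc i mod (n - 1))) | i. i < n - 1}"

definition helm_edges :: "nat \<Rightarrow> helm_vertex rel" where
  "helm_edges n = wheel_edges n \<union> {(Rim i, Pendant i) | i. i < n - 1}"

definition wheel :: "nat \<Rightarrow> helm_vertex pair_pre_digraph" where
  "wheel n = \<lparr> pverts = insert Hub (Rim ` {..<n - 1}),
               parcs = wheel_edges n \<union> (wheel_edges n)\<inverse> \<rparr>"

definition helm :: "nat \<Rightarrow> helm_vertex pair_pre_digraph" where
  "helm n = \<lparr> pverts = pverts (wheel n) \<union> Pendant ` {..<n - 1},
              parcs = helm_edges n \<union> (helm_edges n)\<inverse> \<rparr>"

lemma Suc_mod_neq: "2 \<le> m \<Longrightarrow> i < m \<Longrightarrow> Suc i mod m \<noteq> i"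
  by (cases "Suc i = m") auto

lemma pair_graph_wheel:
  assumes "4 \<le> n"
  shows "pair_graph (wheel n)"
proof -
  have 0: "0 < n - 1" "2 \<le> n - 1" using assms by auto
  have sub: "wheel_edges n \<subseteq> pverts (wheel n) \<times> pverts (wheel n)"
    using 0 by (auto simp: wheel_edges_def wheel_def)
  have irr: "(u, u) \<notin> wheel_edges n" for u
    using 0(2) by (auto simp: wheel_edges_def dest: Suc_mod_neq)
  have fin: "finite (pverts (wheel n))" by (simp add: wheel_def)
  have arcs: "parcs (wheel n) = wheel_edges n \<union> (wheel_edges n)\<inverse>" by (simp add: wheel_def)
  have "finite (parcs (wheel n))"
    using sub fin unfolding arcs by (meson finite_SigmaI finite_UnI finite_converse finite_subset)
  with sub irr fin show ?thesis
    by unfold_locales (auto simp: arcs arc_to_ends_def symmetric_def sym_def)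
qed

lemma pair_graph_helm:
  assumes "4 \<le> n"
  shows "pair_graph (helm n)"
proof -
  have 0: "0 < n - 1" "2 \<le> n - 1" using assms by auto
  have sub: "helm_edges n \<subseteq> pverts (helm n) \<times> pverts (helm n)"
    using 0 by (auto simp: wheel_edges_def helm_edges_def wheel_def helm_def)
  have irr: "(u, u) \<notin> helm_edges n" for u
    using 0(2) by (auto simp: helm_edges_def wheel_edges_def dest: Suc_mod_neq)
  have fin: "finite (pverts (helm n))" by (simp add: wheel_def helm_def)
  have arcs: "parcs (helm n) = helm_edges n \<union> (helm_edges n)\<inverse>" by (simp add: helm_def)
  have "finite (parcs (helm n))"
    using sub fin unfolding arcs by (meson finite_SigmaI finite_UnI finite_converse finite_subset)
  with sub irr fin show ?thesis
    by unfold_locales (auto simp: arcs arc_to_ends_def symmetric_def sym_def)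
qed

lemma card_wheel: "1 \<le> n \<Longrightarrow> card (pverts (wheel n)) = n"
  by (simp add: wheel_def card_insert_if card_image inj_on_def image_iff)

lemma card_helm: "1 \<le> n \<Longrightarrow> card (pverts (helm n)) = 2 * n - 1"
proof -
  assume "1 \<le> n"
  moreover have "card (pverts (helm n)) = card (pverts (wheel n)) + card (Pendant ` {..<n - 1})"
    unfolding helm_def by (simp, subst card_Un_disjoint) (auto simp: wheel_def)
  ultimately show ?thesis by (simp add: card_wheel card_image inj_on_def)
qed

section \<open>The summands\<close>

definition p_poly :: "'a pair_pre_digraph \<Rightarrow> 'a set \<Rightarrow> int poly" where
  "p_poly G Q =
     (if disjoint_visible G Q
      then (\<Sum>\<Omega>\<in>max_abs_c_visible_sets G Q. ([:1, 1:] ^ card \<Omega> - 1) * [:0, 1:] ^ card Q)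
      else (\<Sum>J\<in>{J. J \<noteq> {} \<and> J \<subseteq> max_abs_c_visible_sets G Q}.
              (-1) ^ (card J + 1) * ([:1, 1:] ^ card (\<Inter>J) - 1) * [:0, 1:] ^ card Q))"

text \<open>
  For \<open>h \<notin> Q\<close> the summand enumerates the nonempty sets of pendants hanging on the rim vertices outside
  \<open>Q\<close>, of which there are one less than the vertices outside \<open>Q\<close>. The second \<open>- 1\<close> in the formula is
  missing in the source, which prints \<open>((1+x)^(|Q'|-1)) x^|Q|\<close> with \<open>Q'\<close> the complement of \<open>Q\<close>.
  It removes the empty set of pendants, which the visibility polynomial of the wheel already counts.
\<close>

definition w_poly :: "'a pair_pre_digraph \<Rightarrow> 'a \<Rightarrow> 'a set \<Rightarrow> int poly" where
  "w_poly G h Q =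
     (if h \<notin> Q then ([:1, 1:] ^ (card (pverts G - Q) - 1) - 1) * [:0, 1:] ^ card Q
      else p_poly G Q)"

end

theory Submission
  imports Defs
begin

text \<open>
  A pendant never lies inside a path, so the visibility of pendants reduces to that of the rim
  vertices carrying them. Hence \<open>Q \<union> {p\<^sub>i. i \<in> S}\<close>, with \<open>Q\<close> in the wheel and \<open>p\<^sub>i\<close> the pendant on the
  rim vertex \<open>r\<^sub>i\<close>, is a mutual-visibility set of the helm iff \<open>{r\<^sub>i. i \<in> S}\<close> is absolute
  \<open>c\<^sub>Q\<close>-visible in the wheel, the only exceptions being the pairs \<open>{r\<^sub>i, p\<^sub>i}\<close>. These pairs give
  \<open>(n - 1) x\<^sup>2\<close>. For fixed \<open>Q\<close> the absolute \<open>c\<^sub>Q\<close>-visible sets are closed under subsets, so they are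
  counted by inclusion-exclusion over the maximal ones when \<open>h \<in> Q\<close>; when \<open>h \<notin> Q\<close>, every set of rim
  vertices outside \<open>Q\<close> qualifies, because the hub joins all rim vertices. The empty set of pendants
  gives the polynomial of the wheel, and \<open>Q = {}\<close> gives \<open>(1 + x)\<^bsup>n-1\<^esup> - 1\<close>.
\<close>

section \<open>Visibility and pendant vertices\<close>

lemma visible_pair_refl: "u \<in> pverts G \<Longrightarrow> visible_pair G X u u"
  unfolding visible_pair_def shortest_path_def
  by (intro exI[of _ "[u]"]) (auto simp: vpath_self)

text \<open>A path meets only vertices of \<open>G\<close>, so only the trace of the blocking set on
  \<open>pverts G\<close> matters. This allows pendants to be dropped from the blocking set when
  passing from the helm to the wheel.\<close>

lemma visible_pair_cong:
  assumes "X \<inter> pverts G = Y \<inter> pverts G"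
  shows "visible_pair G X u v \<longleftrightarrow> visible_pair G Y u v"
proof -
  have "set p \<inter> X = set p \<inter> Y" if "shortest_path G u v p" for p
  proof -
    have "set p \<subseteq> pverts G"
      using that unfolding shortest_path_def vpath_def vwalk_def by simp
    then show ?thesis using assms by blast
  qed
  then show ?thesis unfolding visible_pair_def by auto
qed

lemma mutual_visibility_set_subset: "mutual_visibility_set G X \<Longrightarrow> X \<subseteq> pverts G"
  by (simp add: mutual_visibility_set_def visible_set_def)

section \<open>Reversal of paths, and leaves, in symmetric digraphs\<close>

context pair_sym_digraph
begin

lemma vpath_rev: "vpath p G \<Longrightarrow> vpath (rev p) G"
  using arcs_symmetric by (fastforce simp: vpath_def vwalk_def set_vwalk_arcs_rev)

lemma shortest_path_rev:
  assumes "shortest_path G u v p"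
  shows "shortest_path G v u (rev p)"
proof -
  have ends: "hd (rev q) = last q \<and> last (rev q) = hd q" if "vpath q G" for q
    using that by (auto simp: vpath_def vwalk_def hd_rev last_rev)
  show ?thesis
    unfolding shortest_path_def
  proof (intro conjI allI impI)
    show "vpath (rev p) G" "hd (rev p) = v" "last (rev p) = u"
      using assms ends by (auto simp: shortest_path_def vpath_rev)
    fix q assume q: "vpath q G \<and> hd q = v \<and> last q = u"
    then have "vpath (rev q) G \<and> hd (rev q) = u \<and> last (rev q) = v"
      using ends by (auto simp: vpath_rev)
    then have "vwalk_length p \<le> vwalk_length (rev q)"
      using assms unfolding shortest_path_def by blast
    then show "vwalk_length (rev p) \<le> vwalk_length q" by simp
  qed
qed

lemma visible_pair_sym: "visible_pair G X u v \<longleftrightarrow> visible_pair G X v u"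
  unfolding visible_pair_def by (metis shortest_path_rev set_rev insert_commute)

text \<open>An interior vertex of a path has two different neighbours on it, its predecessor and its
  successor, whereas \<open>p\<close> has at most one neighbour.\<close>

lemma pendant_not_interior:
  assumes leaf: "\<And>v. (p, v) \<in> parcs G \<Longrightarrow> v = r"
    and q: "vpath q G" and "p \<in> set q"
  shows "hd q = p \<or> last q = p"
proof (rule ccontr)
  assume ends: "\<not> ?thesis"
  obtain ys zs where eq: "q = ys @ p # zs" using \<open>p \<in> set q\<close> by (meson split_list)
  have ne: "ys \<noteq> []" "zs \<noteq> []" using ends eq by (auto simp: hd_append)
  have "set (vwalk_arcs (ys @ p # zs)) \<subseteq> parcs G" and dist: "distinct q"
    using q eq by (auto simp: vpath_def vwalk_def)
  then have "(last ys, p) \<in> parcs G" "(p, hd zs) \<in> parcs G"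
    using ne by (auto simp: vwalk_arcs_append)
  \<comment> \<open>Symmetry turns the arc entering \<open>p\<close> into one leaving it, so both
    neighbours on the path equal \<open>r\<close>.\<close>
  then have "last ys = hd zs" using leaf arcs_symmetric by metis
  with dist ne eq show False
    by (metis IntI distinct_append empty_iff hd_in_set last_in_set list.set_intros(2))
qed

text \<open>Prefixing \<open>p\<close> turns the paths from \<open>r\<close> to \<open>v\<close>
  into exactly the paths from \<open>p\<close> to \<open>v\<close> and lengthens each by one, so
  minimality carries over both ways.\<close>

lemma shortest_path_pendant:
  assumes leaf: "\<And>v. (p, v) \<in> parcs G \<longleftrightarrow> v = r" and "p \<noteq> r" "v \<noteq> p"
  shows "shortest_path G p v P \<longleftrightarrow> (\<exists>q. P = p # q \<and> p \<notin> set q \<and> shortest_path G r v q)"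
proof -
  have arc: "(p, r) \<in> parcs G" using leaf by blast
  \<comment> \<open>If \<open>p\<close> lay on \<open>q\<close> it would be an end of
    \<open>q\<close>, but the ends \<open>r\<close> and \<open>v\<close> both differ from
    \<open>p\<close>.\<close>
  have not_mem: "p \<notin> set q" if "vpath q G" "hd q = r" "last q = v" for q
    using pendant_not_interior[of p r q] leaf that assms by blast
  have ext: "vpath (p # q) G \<and> last (p # q) = v" if "vpath q G" "hd q = r" "last q = v" for q
    using that not_mem[OF that] arc
    by (auto simp: vpath_def vwalk_def in_arcsD1)
  have dec: "\<exists>q. P = p # q \<and> p \<notin> set q \<and> vpath q G \<and> hd q = r \<and> last q = v"
    if P: "vpath P G" "hd P = p" "last P = v" for P
  proof -
    obtain q where q: "P = p # q" using P by (cases P) (auto simp: vpath_def vwalk_def)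
    with P \<open>v \<noteq> p\<close> have "q \<noteq> []" by auto
    with P q leaf show ?thesis by (auto simp: vpath_def vwalk_def)
  qed
  show ?thesis
  proof
    assume P: "shortest_path G p v P"
    then obtain q where q: "P = p # q" "p \<notin> set q" "vpath q G" "hd q = r" "last q = v"
      using dec unfolding shortest_path_def by blast
    have "vwalk_length q \<le> vwalk_length q'" if "vpath q' G" "hd q' = r" "last q' = v" for q'
    proof -
      have "vwalk_length (p # q) \<le> vwalk_length (p # q')"
        using P q ext[OF that] unfolding shortest_path_def by auto
      then show ?thesis by simp
    qed
    with q show "\<exists>q. P = p # q \<and> p \<notin> set q \<and> shortest_path G r v q"
      unfolding shortest_path_def by blast
  next
    assume "\<exists>q. P = p # q \<and> p \<notin> set q \<and> shortest_path G r v q"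
    then obtain q where q: "P = p # q" "shortest_path G r v q" by blast
    have "vwalk_length P \<le> vwalk_length P'" if "vpath P' G" "hd P' = p" "last P' = v" for P'
    proof -
      obtain q' where q': "P' = p # q'" "vpath q' G" "hd q' = r" "last q' = v"
        using dec[OF \<open>vpath P' G\<close> \<open>hd P' = p\<close> \<open>last P' = v\<close>] by blast
      then have "vwalk_length q \<le> vwalk_length q'" "q' \<noteq> []"
        using q unfolding shortest_path_def by (auto simp: vpath_def vwalk_def)
      then show ?thesis using q q' by (cases q') auto
    qed
    then show "shortest_path G p v P"
      using q ext unfolding shortest_path_def by simp
  qed
qed

text \<open>Every path from \<open>p\<close> to \<open>v\<close> runs through \<open>r\<close>. So
  \<open>r\<close> blocks it when \<open>r \<in> X\<close>, unless \<open>r\<close> is itself the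
  other end.\<close>

lemma visible_pair_pendant:
  assumes leaf: "\<And>v. (p, v) \<in> parcs G \<longleftrightarrow> v = r" and "p \<noteq> r" "v \<noteq> p"
  shows "visible_pair G X p v \<longleftrightarrow> visible_pair G X r v \<and> (r \<in> X \<longrightarrow> r = v)"
proof -
  have r: "r \<in> set q \<and> p \<notin> set q" if "shortest_path G r v q" for q
  proof
    show "r \<in> set q"
      using that by (cases q) (auto simp: shortest_path_def vpath_def vwalk_def)
    show "p \<notin> set q"
      using that pendant_not_interior[of p r q] leaf assms unfolding shortest_path_def by blast
  qed
  have "visible_pair G X p v \<longleftrightarrow>
      (\<exists>q. p \<notin> set q \<and> shortest_path G r v q \<and> set (p # q) \<inter> X \<subseteq> {p, v})"
    unfolding visible_pair_def shortest_path_pendant[OF assms] by blast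
  \<comment> \<open>Since \<open>r\<close> lies on \<open>q\<close> and \<open>p\<close> does not,
    replacing \<open>p\<close> by \<open>r\<close> among the allowed ends forgives only
    \<open>r\<close> itself, which the last conjunct then treats separately.\<close>
  also have "\<dots> \<longleftrightarrow> (\<exists>q. shortest_path G r v q \<and> set q \<inter> X \<subseteq> {r, v} \<and> (r \<in> X \<longrightarrow> r = v))"
    by (rule ex_cong1) (use r \<open>v \<noteq> p\<close> \<open>p \<noteq> r\<close> in \<open>auto; blast\<close>)
  finally show ?thesis unfolding visible_pair_def by blast
qed

text \<open>Vertices with at most one neighbour lie on no path between two other vertices. Hence
  \<open>G\<close> and its induced subgraph \<open>H\<close> have the same paths between vertices of
  \<open>H\<close>, and so the same shortest ones.\<close>

lemma visible_pair_remove_pendants: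
  assumes verts: "pverts H \<subseteq> pverts G"
    and arcs: "parcs H = parcs G \<inter> (pverts H \<times> pverts H)"
    and leaf: "\<And>p. p \<in> pverts G - pverts H \<Longrightarrow> \<exists>r. \<forall>v. (p, v) \<in> parcs G \<longrightarrow> v = r"
    and uv: "u \<in> pverts H" "v \<in> pverts H"
  shows "visible_pair G X u v \<longleftrightarrow> visible_pair H X u v"
proof -
  have "vpath q G \<longleftrightarrow> vpath q H" if ends: "hd q = u" "last q = v" for q
  proof
    assume q: "vpath q G"
    have sub: "set q \<subseteq> pverts H"
    proof
      fix p assume p: "p \<in> set q"
      then have "p \<in> pverts G" using q by (auto simp: vpath_def vwalk_def)
      then show "p \<in> pverts H"
        using pendant_not_interior[OF _ q p] leaf[of p] ends uv by blast
    qed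
    moreover have "set (vwalk_arcs q) \<subseteq> parcs H"
      using q sub arcs_in_vwalk_arcs[of _ q] unfolding arcs by (fastforce simp: vpath_def vwalk_def)
    ultimately show "vpath q H" using q by (auto simp: vpath_def vwalk_def)
  next
    assume "vpath q H"
    then show "vpath q G" using verts arcs by (auto simp: vpath_def vwalk_def)
  qed
  then have "shortest_path G u v = shortest_path H u v"
    unfolding shortest_path_def by (intro ext) metis
  then show ?thesis unfolding visible_pair_def by simp
qed

end

section \<open>The generating function of a family of sets\<close>

text \<open>Summing over the sets themselves, not over coefficients, makes bijections and
  inclusion-exclusion directly applicable.\<close>

definition set_gf :: "'a set set \<Rightarrow> int poly" where
  "set_gf \<F> = (\<Sum>X\<in>\<F>. [:0, 1:] ^ card X)"

lemma set_gf_Pow: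
  assumes "finite A"
  shows "set_gf (Pow A) = [:1, 1:] ^ card A"
proof -
  have "[:1, 1:] = [:0, 1:] + (1 :: int poly)" by (simp add: one_pCons)
  then show ?thesis
    using prod_add[OF assms, of "\<lambda>_. [:0, 1:]" "\<lambda>_. 1 :: int poly"] by (simp add: set_gf_def)
qed

lemma set_gf_remove_empty:
  "finite \<F> \<Longrightarrow> {} \<in> \<F> \<Longrightarrow> set_gf (\<F> - {{}}) = set_gf \<F> - 1"
  by (simp add: set_gf_def sum_diff1)

lemma set_gf_union_disjnt:
  "finite \<F> \<Longrightarrow> finite \<G> \<Longrightarrow> disjnt \<F> \<G> \<Longrightarrow> set_gf (\<F> \<union> \<G>) = set_gf \<F> + set_gf \<G>"
  by (simp add: set_gf_def sum.union_disjoint disjnt_def)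

section \<open>Visibility polynomials and \<open>p_poly\<close> as generating functions\<close>

lemma visibility_poly_eq_set_gf:
  assumes "finite (pverts G)"
  shows "visibility_poly G = set_gf {X. mutual_visibility_set G X}"
proof -
  let ?M = "{X. mutual_visibility_set G X}"
  have sub: "?M \<subseteq> Pow (pverts G)" by (auto dest: mutual_visibility_set_subset)
  then have fin: "finite ?M" using assms finite_subset by blast
  have "set_gf ?M = (\<Sum>i\<le>card (pverts G). \<Sum>X\<in>{X\<in>?M. card X = i}. [:0, 1:] ^ card X)"
    unfolding set_gf_def using sub assms
    by (intro sum.group[symmetric] fin) (auto intro: card_mono)
  also have "\<dots> = visibility_poly G"
    unfolding visibility_poly_def
    by (intro sum.cong refl) (simp add: monom_altdef of_nat_poly)
  finally show ?thesis by simp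
qed

text \<open>Every condition on \<open>W\<close> is universal over its elements. So the family is
  determined by its maximal members.\<close>

lemma abs_c_visible_set_mono:
  "abs_c_visible_set G Q W \<Longrightarrow> W' \<subseteq> W \<Longrightarrow> abs_c_visible_set G Q W'"
  unfolding abs_c_visible_set_def c_visible_set_def visible_set_def by blast

text \<open>The nonempty absolute \<open>c_Q\<close>-visible sets are the union of the families of
  nonempty subsets of the maximal ones. Both branches of \<open>p_poly\<close> evaluate this one
  union: by plain addition if the families are disjoint, by inclusion-exclusion in general.\<close>

lemma p_poly_eq_set_gf:
  assumes fin: "finite (pverts G)"
  shows "p_poly G Q = set_gf ({W. abs_c_visible_set G Q W} - {{}}) * [:0, 1:] ^ card Q"
proof -
  let ?\<Gamma> = "max_abs_c_visible_sets G Q"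
  \<comment> \<open>Leaving out the empty set makes \<open>\<N> \<Omega>\<close> and
    \<open>\<N> \<Omega>'\<close> disjoint whenever \<open>\<Omega>\<close> and
    \<open>\<Omega>'\<close> are.\<close>
  define \<N> where "\<N> \<Omega> = Pow \<Omega> - {{}}" for \<Omega> :: "'a set"
  have sub: "W \<subseteq> pverts G" if "abs_c_visible_set G Q W" for W
    using that by (auto simp: abs_c_visible_set_def c_visible_set_def)
  have fin_abs: "finite {W. abs_c_visible_set G Q W}"
    by (rule finite_subset[of _ "Pow (pverts G)"]) (use sub fin in auto)
  then have fin_\<Gamma>: "finite ?\<Gamma>"
    by (rule rev_finite_subset) (auto simp: max_abs_c_visible_sets_def)
  have fin_\<Omega>: "finite \<Omega>" if "\<Omega> \<in> ?\<Gamma>" for \<Omega>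
    using that sub fin by (auto simp: max_abs_c_visible_sets_def intro: finite_subset)
  have gf: "set_gf (\<N> \<Omega>) = [:1, 1:] ^ card \<Omega> - 1" if "finite \<Omega>" for \<Omega>
    using that by (simp add: \<N>_def set_gf_remove_empty set_gf_Pow)
  have "\<exists>\<Omega>\<in>?\<Gamma>. W \<subseteq> \<Omega>" if W: "abs_c_visible_set G Q W" for W
  proof -
    obtain \<Omega> where "abs_c_visible_set G Q \<Omega>" "W \<subseteq> \<Omega>"
        "\<And>W'. abs_c_visible_set G Q W' \<Longrightarrow> \<Omega> \<subseteq> W' \<Longrightarrow> \<Omega> = W'"
      using finite_has_maximal2[OF fin_abs, of W] W by auto
    then show ?thesis unfolding max_abs_c_visible_sets_def by blast
  qed
  then have cover: "{W. abs_c_visible_set G Q W} - {{}} = \<Union>(\<N> ` ?\<Gamma>)"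
    by (auto simp: \<N>_def max_abs_c_visible_sets_def dest: abs_c_visible_set_mono)
  have "set_gf (\<Union>(\<N> ` ?\<Gamma>)) * [:0, 1:] ^ card Q = p_poly G Q"
  proof (cases "disjoint_visible G Q")
    case True
    then have "\<N> \<Omega> \<inter> \<N> \<Omega>' = {}" if "\<Omega> \<in> ?\<Gamma>" "\<Omega>' \<in> ?\<Gamma>" "\<Omega> \<noteq> \<Omega>'" for \<Omega> \<Omega>'
      using that unfolding disjoint_visible_def pairwise_def disjnt_def \<N>_def by blast
    then have "set_gf (\<Union>(\<N> ` ?\<Gamma>)) = (\<Sum>\<Omega>\<in>?\<Gamma>. set_gf (\<N> \<Omega>))"
      unfolding set_gf_def using fin_\<Gamma> fin_\<Omega>
      by (intro sum.UNION_disjoint) (auto simp: \<N>_def)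
    also have "\<dots> = (\<Sum>\<Omega>\<in>?\<Gamma>. [:1, 1:] ^ card \<Omega> - 1)"
      using gf fin_\<Omega> by simp
    finally show ?thesis
      using True by (simp add: p_poly_def sum_distrib_right)
  next
    case False
    \<comment> \<open>Additivity on disjoint finite families is all that inclusion-exclusion asks of
      \<open>set_gf\<close>.\<close>
    interpret Incl_Excl finite "set_gf :: 'a set set \<Rightarrow> int poly"
      by unfold_locales (auto simp: set_gf_union_disjnt)
    have "set_gf (\<Union>(\<N> ` ?\<Gamma>)) =
        (\<Sum>J | J \<subseteq> ?\<Gamma> \<and> J \<noteq> {}. (-1) ^ (card J + 1) * set_gf (\<Inter>(\<N> ` J)))"
      using fin_\<Gamma> fin_\<Omega> by (intro restricted_indexed) (auto simp: \<N>_def)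
    also have "\<dots> = (\<Sum>J | J \<subseteq> ?\<Gamma> \<and> J \<noteq> {}. (-1) ^ (card J + 1) * ([:1, 1:] ^ card (\<Inter>J) - 1))"
    proof (rule sum.cong[OF refl])
      fix J assume "J \<in> {J. J \<subseteq> ?\<Gamma> \<and> J \<noteq> {}}"
      then obtain \<Omega> where J: "J \<noteq> {}" "\<Omega> \<in> J" "finite \<Omega>" using fin_\<Omega> by blast
      then have "finite (\<Inter>J)" by (meson Inter_lower finite_subset)
      \<comment> \<open>Lying below every member of \<open>J\<close> means lying below
        \<open>\<Inter>J\<close>; nonemptiness of the subset is read off from the member
        \<open>\<Omega>\<close> of \<open>J\<close>.\<close>
      moreover have "\<Inter>(\<N> ` J) = \<N> (\<Inter>J)" using J by (auto simp: \<N>_def)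
      ultimately show "(-1) ^ (card J + 1) * set_gf (\<Inter>(\<N> ` J)) =
          (-1) ^ (card J + 1) * ([:1, 1:] ^ card (\<Inter>J) - 1)"
        using gf by simp
    qed
    finally show ?thesis
      using False by (simp add: p_poly_def sum_distrib_right conj_commute)
  qed
  then show ?thesis by (simp add: cover)
qed

section \<open>The wheel and the helm\<close>

text \<open>Two vertices of the wheel have distance at most 2. At distance 2 both are on the rim,
  and the path through the hub is a shortest one that \<open>X\<close> does not block.\<close>

lemma visible_pair_wheel:
  assumes "4 \<le> n" and uv: "u \<in> pverts (wheel n)" "v \<in> pverts (wheel n)" and "Hub \<notin> X"
  shows "visible_pair (wheel n) X u v"
proof -
  let ?G = "wheel n"
  consider "u = v" | "u \<noteq> v" "(u, v) \<in> parcs ?G" | "u \<noteq> v" "(u, v) \<notin> parcs ?G" by blast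
  then show ?thesis
  proof cases
    case 1
    then show ?thesis using uv visible_pair_refl by simp
  next
    case 2
    have "vwalk_length q \<ge> 1" if "vpath q ?G \<and> hd q = u \<and> last q = v" for q
      using that 2 by (cases q rule: vwalk_arcs.cases) (auto simp: vpath_def vwalk_def)
    then have "shortest_path ?G u v [u, v]"
      using 2 uv by (auto simp: shortest_path_def vpath_def vwalk_def)
    then show ?thesis unfolding visible_pair_def by (intro exI[of _ "[u, v]"]) auto
  next
    case 3
    have "(Hub, w) \<in> parcs ?G" "(w, Hub) \<in> parcs ?G" if "w \<in> pverts ?G" "w \<noteq> Hub" for w
      using that by (auto simp: wheel_def wheel_edges_def)
    with 3 uv have arcs: "u \<noteq> Hub" "v \<noteq> Hub" "(u, Hub) \<in> parcs ?G" "(Hub, v) \<in> parcs ?G"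
      by blast+
    have "vwalk_length q \<ge> 2" if "vpath q ?G \<and> hd q = u \<and> last q = v" for q
    proof (rule ccontr)
      assume "\<not> ?thesis"
      with that 3 show False
        by (cases q rule: vwalk_arcs.cases) (auto simp: vpath_def vwalk_def Suc_le_eq split: if_splits)
    qed
    moreover have "vpath [u, Hub, v] ?G"
      using 3 uv arcs by (auto simp: vpath_def vwalk_def wheel_def)
    ultimately have "shortest_path ?G u v [u, Hub, v]"
      by (auto simp: shortest_path_def numeral_2_eq_2)
    then show ?thesis using \<open>Hub \<notin> X\<close>
      unfolding visible_pair_def by (intro exI[of _ "[u, Hub, v]"]) auto
  qed
qed

lemma abs_c_visible_set_wheel:
  assumes "4 \<le> n" "Hub \<notin> Q" "Q \<subseteq> pverts (wheel n)"
  shows "abs_c_visible_set (wheel n) Q W \<longleftrightarrow> W \<subseteq> pverts (wheel n) - Q"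
  using assms visible_pair_wheel[OF assms(1) _ _ assms(2)]
  by (auto simp: abs_c_visible_set_def c_visible_set_def mutual_visibility_set_def visible_set_def
      subset_iff)

text \<open>Brings both cases of \<open>w_poly\<close> into one form. \<open>W\<close> avoids the
  hub because no pendant hangs there: automatic for \<open>Hub \<in> Q\<close>, and the source of
  the exponent's \<open>- 1\<close> for \<open>Hub \<notin> Q\<close>. The outer \<open>- 1\<close>
  removes \<open>W = {}\<close>.\<close>

lemma w_poly_wheel:
  assumes n: "4 \<le> n" and Q: "mutual_visibility_set (wheel n) Q"
  shows "w_poly (wheel n) Hub Q =
    (set_gf {W. abs_c_visible_set (wheel n) Q W \<and> Hub \<notin> W} - 1) * [:0, 1:] ^ card Q"
proof -
  let ?G = "wheel n"
  let ?F = "{W. abs_c_visible_set ?G Q W \<and> Hub \<notin> W}"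
  have fin: "finite (pverts ?G)" by (simp add: wheel_def)
  have QV: "Q \<subseteq> pverts ?G" using Q by (rule mutual_visibility_set_subset)
  show ?thesis
  proof (cases "Hub \<in> Q")
    case True
    have F: "?F = {W. abs_c_visible_set ?G Q W}"
      using True by (auto simp: abs_c_visible_set_def c_visible_set_def)
    have "abs_c_visible_set ?G Q {}"
      using Q by (simp add: abs_c_visible_set_def c_visible_set_def visible_set_def)
    moreover have "finite {W. abs_c_visible_set ?G Q W}"
      by (rule finite_subset[of _ "Pow (pverts ?G)"])
        (use fin in \<open>auto simp: abs_c_visible_set_def c_visible_set_def\<close>)
    ultimately show ?thesis
      using True by (simp add: w_poly_def p_poly_eq_set_gf[OF fin] F set_gf_remove_empty)
  next
    case False
    then have "?F = Pow (pverts ?G - Q - {Hub})"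
      using abs_c_visible_set_wheel[OF n False QV] by auto
    moreover have "card (pverts ?G - Q - {Hub}) = card (pverts ?G - Q) - 1"
      using False fin by (subst card_Diff_singleton) (auto simp: wheel_def)
    ultimately show ?thesis
      using False fin by (simp add: w_poly_def set_gf_Pow)
  qed
qed

section \<open>Mutual-visibility sets of the helm\<close>

text \<open>If no pendant of the set hangs on a vertex of \<open>Q\<close>, each pendant sees
  exactly what its rim vertex sees. Otherwise some \<open>Rim i\<close> in \<open>Q\<close> cuts
  \<open>Pendant i\<close> off from everything but \<open>Rim i\<close>, which leaves only the
  exceptional pairs.\<close>

lemma mutual_visibility_set_helm:
  assumes n: "4 \<le> n" and Q: "Q \<subseteq> pverts (wheel n)" and S: "S \<subseteq> {..<n - 1}"
  shows "mutual_visibility_set (helm n) (Q \<union> Pendant ` S) \<longleftrightarrow>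
    abs_c_visible_set (wheel n) Q (Rim ` S) \<or> (\<exists>i<n - 1. Q = {Rim i} \<and> S = {i})"
proof -
  interpret helm: pair_graph "helm n" using n by (rule pair_graph_helm)
  interpret wheel: pair_graph "wheel n" using n by (rule pair_graph_wheel)
  define X where "X = Q \<union> Pendant ` S"
  let ?vis = "visible_pair (wheel n) Q"
  have pend_arc: "(Pendant i, v) \<in> parcs (helm n) \<longleftrightarrow> v = Rim i" if "i < n - 1" for i v
    using that by (auto simp: helm_def helm_edges_def wheel_edges_def)
  have rim: "Rim i \<in> pverts (wheel n)" if "i < n - 1" for i
    using that by (simp add: wheel_def)
  have XQ: "Rim i \<in> X \<longleftrightarrow> Rim i \<in> Q" for i by (auto simp: X_def)
  have QX: "X \<inter> pverts (wheel n) = Q \<inter> pverts (wheel n)"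
    by (auto simp: X_def wheel_def)
  have base: "visible_pair (helm n) X u v \<longleftrightarrow> ?vis u v"
    if "u \<in> pverts (wheel n)" "v \<in> pverts (wheel n)" for u v
  proof -
    have "visible_pair (helm n) X u v \<longleftrightarrow> visible_pair (wheel n) X u v"
    proof (rule helm.visible_pair_remove_pendants[OF _ _ _ that])
      show "pverts (wheel n) \<subseteq> pverts (helm n)" by (simp add: helm_def)
      have "wheel_edges n = helm_edges n \<inter> pverts (wheel n) \<times> pverts (wheel n)"
        by (auto simp: helm_edges_def wheel_edges_def wheel_def)
      moreover have "parcs (wheel n) = wheel_edges n \<union> (wheel_edges n)\<inverse>"
        and "parcs (helm n) = helm_edges n \<union> (helm_edges n)\<inverse>"
        by (simp_all add: wheel_def helm_def)
      ultimately show "parcs (wheel n) = parcs (helm n) \<inter> (pverts (wheel n) \<times> pverts (wheel n))"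
        by blast
      fix p assume "p \<in> pverts (helm n) - pverts (wheel n)"
      then show "\<exists>r. \<forall>v. (p, v) \<in> parcs (helm n) \<longrightarrow> v = r"
        using pend_arc by (auto simp: helm_def)
    qed
    then show ?thesis using visible_pair_cong[OF QX] by simp
  qed
  \<comment> \<open>The alternative \<open>Rim i = v\<close> is what lets the exceptional pairs
    through.\<close>
  have pend_base: "visible_pair (helm n) X (Pendant i) v \<longleftrightarrow> ?vis (Rim i) v \<and> (Rim i \<in> Q \<longrightarrow> Rim i = v)"
    if "i < n - 1" "v \<in> pverts (wheel n)" for i v
  proof -
    have "v \<noteq> Pendant i" using that by (auto simp: wheel_def)
    then show ?thesis
      using helm.visible_pair_pendant[OF pend_arc[OF that(1)], of v X] base[OF rim that(2)] that XQ
      by auto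
  qed
  have pend_pend: "visible_pair (helm n) X (Pendant i) (Pendant j) \<longleftrightarrow>
      i = j \<or> ?vis (Rim i) (Rim j) \<and> Rim i \<notin> Q \<and> Rim j \<notin> Q"
    if "i < n - 1" "j < n - 1" for i j
  proof (cases "i = j")
    case True
    then show ?thesis using that visible_pair_refl[of "Pendant i" "helm n" X] by (auto simp: helm_def)
  next
    case False
    \<comment> \<open>The two pendants are peeled off one at a time; no exception arises, as a
      pendant is never a rim vertex.\<close>
    have "visible_pair (helm n) X (Pendant i) (Pendant j) \<longleftrightarrow>
        visible_pair (helm n) X (Pendant j) (Rim i) \<and> Rim i \<notin> Q"
      using helm.visible_pair_pendant[OF pend_arc[OF that(1)], of "Pendant j" X] False XQ
        helm.visible_pair_sym by auto
    then show ?thesis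
      using pend_base[OF that(2) rim[OF that(1)]] False wheel.visible_pair_sym by auto
  qed
  have mv: "mutual_visibility_set (helm n) X \<longleftrightarrow>
      (\<forall>u\<in>Q. \<forall>v\<in>Q. ?vis u v) \<and>
      (\<forall>i\<in>S. \<forall>v\<in>Q. ?vis (Rim i) v \<and> (Rim i \<in> Q \<longrightarrow> Rim i = v)) \<and>
      (\<forall>i\<in>S. \<forall>j\<in>S. i = j \<or> ?vis (Rim i) (Rim j) \<and> Rim i \<notin> Q \<and> Rim j \<notin> Q)"
    (is "_ \<longleftrightarrow> ?R")
  proof -
    have split: "(\<forall>u\<in>X. P u) \<longleftrightarrow> (\<forall>u\<in>Q. P u) \<and> (\<forall>i\<in>S. P (Pendant i))" for P
      by (auto simp: X_def)
    have "X \<subseteq> pverts (helm n)" using Q S by (auto simp: X_def helm_def)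
    then have "mutual_visibility_set (helm n) X \<longleftrightarrow>
      (\<forall>u\<in>Q. \<forall>v\<in>Q. visible_pair (helm n) X u v) \<and>
      (\<forall>i\<in>S. \<forall>v\<in>Q. visible_pair (helm n) X (Pendant i) v) \<and>
      (\<forall>i\<in>S. \<forall>j\<in>S. visible_pair (helm n) X (Pendant i) (Pendant j))"
      unfolding mutual_visibility_set_def visible_set_def split
      using helm.visible_pair_sym by meson
    also have "\<dots> \<longleftrightarrow> ?R"
      using Q S by (intro conj_cong ball_cong refl base pend_base pend_pend) auto
    finally show ?thesis .
  qed
  have vis_refl: "?vis u u" if "u \<in> pverts (wheel n)" for u
    using that by (rule visible_pair_refl)
  have RS: "Rim ` S \<subseteq> pverts (wheel n)" using S rim by auto
  show ?thesis
  proof (cases "Rim ` S \<inter> Q = {}")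
    case True
    have rim': "Rim i \<notin> Q" "?vis (Rim i) (Rim i)" if "i \<in> S" for i
      using that RS vis_refl True by blast+
    have "abs_c_visible_set (wheel n) Q (Rim ` S) \<longleftrightarrow>
        (\<forall>u\<in>Q. \<forall>v\<in>Q. ?vis u v) \<and> (\<forall>i\<in>S. \<forall>v\<in>Q. ?vis (Rim i) v) \<and>
        (\<forall>i\<in>S. \<forall>j\<in>S. ?vis (Rim i) (Rim j))"
    proof -
      have "visible_set (wheel n) Q {u, w} \<longleftrightarrow> ?vis w u" if "u \<in> Q" "w \<in> Rim ` S" for u w
      proof -
        have "u \<in> pverts (wheel n)" "w \<in> pverts (wheel n)" using that Q RS by blast+
        then show ?thesis
          using vis_refl wheel.visible_pair_sym[of Q u w] by (simp add: visible_set_def)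
      qed
      moreover have "Rim ` S \<subseteq> pverts (wheel n) - Q" using RS True by blast
      ultimately have "abs_c_visible_set (wheel n) Q (Rim ` S) \<longleftrightarrow>
          visible_set (wheel n) Q (Rim ` S) \<and> (\<forall>u\<in>Q. \<forall>w\<in>Rim ` S. ?vis w u) \<and> visible_set (wheel n) Q Q"
        unfolding abs_c_visible_set_def c_visible_set_def mutual_visibility_set_def by simp
      then show ?thesis using Q RS unfolding visible_set_def by blast
    qed
    moreover have "\<not> (\<exists>i<n - 1. Q = {Rim i} \<and> S = {i})" using True by auto
    moreover have "mutual_visibility_set (helm n) X \<longleftrightarrow>
        (\<forall>u\<in>Q. \<forall>v\<in>Q. ?vis u v) \<and> (\<forall>i\<in>S. \<forall>v\<in>Q. ?vis (Rim i) v) \<and>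
        (\<forall>i\<in>S. \<forall>j\<in>S. ?vis (Rim i) (Rim j))"
      unfolding mv by (intro conj_cong ball_cong refl) (use rim' in auto)
    ultimately show ?thesis unfolding X_def by argo
  next
    case False
    then obtain i where i: "i \<in> S" "Rim i \<in> Q" by blast
    have "mutual_visibility_set (helm n) X \<longleftrightarrow> Q = {Rim i} \<and> S = {i}"
    proof
      assume "mutual_visibility_set (helm n) X"
      \<comment> \<open>The second fact comes from the pendant-pendant condition, the first from the
        pendant-wheel condition.\<close>
      then have *: "\<forall>v\<in>Q. Rim i \<in> Q \<longrightarrow> Rim i = v" "\<forall>j\<in>S. i = j \<or> Rim i \<notin> Q"
        using i(1) unfolding mv by auto
      have "v = Rim i" if "v \<in> Q" for v using bspec[OF *(1) that] i(2) by simp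
      moreover have "j = i" if "j \<in> S" for j using bspec[OF *(2) that] i(2) by simp
      ultimately show "Q = {Rim i} \<and> S = {i}" using i by blast
    next
      assume "Q = {Rim i} \<and> S = {i}"
      moreover have "?vis (Rim i) (Rim i)" using i Q vis_refl by blast
      ultimately show "mutual_visibility_set (helm n) X" unfolding mv by simp
    qed
    moreover have "\<not> abs_c_visible_set (wheel n) Q (Rim ` S)"
      using False by (auto simp: abs_c_visible_set_def c_visible_set_def)
    moreover have "(\<exists>j<n - 1. Q = {Rim j} \<and> S = {j}) \<longleftrightarrow> Q = {Rim i} \<and> S = {i}"
      using i(1) S by blast
    ultimately show ?thesis unfolding X_def by argo
  qed
qed

text \<open>A mutual-visibility set splits uniquely into its wheel part \<open>Q\<close> and its
  pendant indices \<open>S\<close>, and its size is \<open>card Q + card S\<close>. Summing over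
  \<open>S\<close> first gives the inner generating function.\<close>

lemma visibility_poly_helm:
  assumes n: "4 \<le> n"
  shows "visibility_poly (helm n) =
    (\<Sum>Q | mutual_visibility_set (wheel n) Q.
       set_gf {W. abs_c_visible_set (wheel n) Q W \<and> Hub \<notin> W} * [:0, 1:] ^ card Q)
    + of_nat (n - 1) * [:0, 1:] ^ 2"
proof -
  let ?V = "pverts (wheel n)" and ?I = "{..<n - 1}"
  let ?M = "{Q. mutual_visibility_set (wheel n) Q}"
  let ?S = "\<lambda>Q. {S. abs_c_visible_set (wheel n) Q (Rim ` S)}"
  \<comment> \<open>The \<open>n - 1\<close> exceptional pairs of a rim vertex and its pendant; each
    contributes \<open>x^2\<close>.\<close>
  let ?D = "(\<lambda>i. ({Rim i}, {i})) ` ?I"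
  have fin: "finite ?V" by (simp add: wheel_def)
  have fin_helm: "finite (pverts (helm n))" using fin by (simp add: helm_def)
  have MV: "?M \<subseteq> Pow ?V" by (auto dest: mutual_visibility_set_subset)
  have finM: "finite ?M" using MV fin finite_subset by blast
  have SI: "?S Q \<subseteq> Pow ?I" for Q
    by (auto simp: abs_c_visible_set_def c_visible_set_def wheel_def)
  have finS: "finite (?S Q)" for Q by (rule finite_subset[OF SI]) simp
  \<comment> \<open>An absolute \<open>c_Q\<close>-visible set avoids \<open>Q\<close>, while in
    \<open>?D\<close> the rim vertex of the pendant lies in \<open>Q\<close>.\<close>
  have disj: "Sigma ?M ?S \<inter> ?D = {}"
    by (auto simp: abs_c_visible_set_def c_visible_set_def)
  have sub: "Sigma ?M ?S \<union> ?D \<subseteq> Pow ?V \<times> Pow ?I"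
    using MV SI by (auto simp: wheel_def)
  have card: "card (Q \<union> Pendant ` S) = card Q + card S" if "Q \<subseteq> ?V" "S \<subseteq> ?I" for Q S
  proof -
    have "Q \<inter> Pendant ` S = {}" using that by (auto simp: wheel_def)
    moreover have "finite Q" "finite S" using that fin finite_subset by auto
    ultimately show ?thesis by (simp add: card_Un_disjoint card_image inj_on_def)
  qed
  have inj: "inj_on (\<lambda>(Q, S). Q \<union> Pendant ` S) (Pow ?V \<times> Pow ?I)"
  proof (rule inj_on_inverseI[where g = "\<lambda>X. (X - range Pendant, {i. Pendant i \<in> X})"])
    fix z assume "z \<in> Pow ?V \<times> Pow ?I"
    then show "(case case z of (Q, S) \<Rightarrow> Q \<union> Pendant ` S of
        X \<Rightarrow> (X - range Pendant, {i. Pendant i \<in> X})) = z"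
      by (auto simp: wheel_def)
  qed
  have bij: "{X. mutual_visibility_set (helm n) X} =
      (\<lambda>(Q, S). Q \<union> Pendant ` S) ` (Sigma ?M ?S \<union> ?D)"
  proof (intro set_eqI iffI)
    fix X assume "X \<in> {X. mutual_visibility_set (helm n) X}"
    then have X: "mutual_visibility_set (helm n) X" by simp
    define Q where "Q = X \<inter> ?V"
    define S where "S = {i\<in>?I. Pendant i \<in> X}"
    have "X \<subseteq> pverts (helm n)" using X by (rule mutual_visibility_set_subset)
    then have X_eq: "X = Q \<union> Pendant ` S" by (auto simp: Q_def S_def helm_def)
    have "abs_c_visible_set (wheel n) Q (Rim ` S) \<or> (\<exists>i<n - 1. Q = {Rim i} \<and> S = {i})"
    proof (subst mutual_visibility_set_helm[OF n, symmetric])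
      show "Q \<subseteq> ?V" "S \<subseteq> ?I" by (auto simp: Q_def S_def)
      show "mutual_visibility_set (helm n) (Q \<union> Pendant ` S)" using X X_eq by simp
    qed
    then have "(Q, S) \<in> Sigma ?M ?S \<union> ?D"
      by (auto simp: abs_c_visible_set_def)
    then show "X \<in> (\<lambda>(Q, S). Q \<union> Pendant ` S) ` (Sigma ?M ?S \<union> ?D)"
      using X_eq by (intro image_eqI[of _ _ "(Q, S)"]) auto
  next
    fix X assume "X \<in> (\<lambda>(Q, S). Q \<union> Pendant ` S) ` (Sigma ?M ?S \<union> ?D)"
    then obtain Q S where QS: "(Q, S) \<in> Sigma ?M ?S \<union> ?D" "X = Q \<union> Pendant ` S" by blast
    then have "Q \<subseteq> ?V" "S \<subseteq> ?I" using sub by blast+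
    then show "X \<in> {X. mutual_visibility_set (helm n) X}"
      using QS mutual_visibility_set_helm[OF n, of Q S] by auto
  qed
  \<comment> \<open>Wheel vertices other than the hub are rim vertices, so \<open>W\<close>
    corresponds to a unique index set of the same size.\<close>
  have gf_rim: "set_gf {W. abs_c_visible_set (wheel n) Q W \<and> Hub \<notin> W} =
      (\<Sum>S\<in>?S Q. [:0, 1:] ^ card S)" for Q
  proof -
    have "{W. abs_c_visible_set (wheel n) Q W \<and> Hub \<notin> W} = (`) Rim ` ?S Q"
    proof (intro set_eqI iffI)
      fix W assume W: "W \<in> {W. abs_c_visible_set (wheel n) Q W \<and> Hub \<notin> W}"
      then have "W \<subseteq> range Rim"
        by (auto simp: abs_c_visible_set_def c_visible_set_def wheel_def)
      then show "W \<in> (`) Rim ` ?S Q" using W by (auto simp: subset_image_iff)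
    qed auto
    moreover have "inj_on ((`) Rim) (?S Q)"
      by (simp add: inj_on_def inj_image_eq_iff)
    ultimately show ?thesis
      by (simp add: set_gf_def sum.reindex card_image inj_on_def)
  qed
  have "visibility_poly (helm n) = (\<Sum>(Q, S)\<in>Sigma ?M ?S \<union> ?D. [:0, 1:] ^ card (Q \<union> Pendant ` S))"
    unfolding visibility_poly_eq_set_gf[OF fin_helm] set_gf_def bij
    by (subst sum.reindex[OF inj_on_subset[OF inj sub]]) (simp add: case_prod_beta)
  also have "\<dots> = (\<Sum>(Q, S)\<in>Sigma ?M ?S \<union> ?D. [:0, 1:] ^ card S * [:0, 1:] ^ card Q)"
    using sub card by (intro sum.cong refl) (auto simp: power_add mult.commute)
  also have "\<dots> = (\<Sum>(Q, S)\<in>Sigma ?M ?S. [:0, 1:] ^ card S * [:0, 1:] ^ card Q)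
      + (\<Sum>(Q, S)\<in>?D. [:0, 1:] ^ card S * [:0, 1:] ^ card Q)"
    using finM finS disj by (intro sum.union_disjoint) auto
  also have "(\<Sum>(Q, S)\<in>?D. [:0, 1:] ^ card S * [:0, 1:] ^ card Q) =
      (of_nat (n - 1) * [:0, 1:] ^ 2 :: int poly)"
    by (simp add: sum.reindex inj_on_def power2_eq_square)
  also have "(\<Sum>(Q, S)\<in>Sigma ?M ?S. [:0, 1:] ^ card S * [:0, 1:] ^ card Q) =
      (\<Sum>Q\<in>?M. \<Sum>S\<in>?S Q. [:0, 1:] ^ card S * [:0, 1:] ^ card Q :: int poly)"
    using finM finS by (simp add: sum.Sigma)
  finally show ?thesis by (simp add: gf_rim sum_distrib_right)
qed

theorem theorem9:
  fixes n :: nat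
  assumes "n \<ge> 8"
  shows "visibility_poly (helm n) =
    visibility_poly (wheel n) + ([:1, 1:] ^ (n - 1) - 1) + of_nat (n - 1) * [:0, 1:] ^ 2
    + (\<Sum>Q\<in>{Q. mutual_visibility_set (wheel n) Q \<and> Q \<noteq> {} \<and> Q \<subset> pverts (wheel n)}.
         w_poly (wheel n) Hub Q)"
proof -
  let ?V = "pverts (wheel n)"
  let ?M = "{Q. mutual_visibility_set (wheel n) Q}"
  let ?N = "{Q. mutual_visibility_set (wheel n) Q \<and> Q \<noteq> {} \<and> Q \<subset> ?V}"
  let ?g = "\<lambda>Q. set_gf {W. abs_c_visible_set (wheel n) Q W \<and> Hub \<notin> W}"
  have n: "4 \<le> n" using assms by simp
  have fin: "finite ?V" by (simp add: wheel_def)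
  have MV: "?M \<subseteq> Pow ?V" by (auto dest: mutual_visibility_set_subset)
  have finM: "finite ?M" using MV fin finite_subset by blast
  \<comment> \<open>The summand for the empty set of pendants is split off; over all
    \<open>Q\<close> these parts add up to the polynomial of the wheel.\<close>
  have w: "?g Q * [:0, 1:] ^ card Q = [:0, 1:] ^ card Q + w_poly (wheel n) Hub Q" if "Q \<in> ?M" for Q
    using that by (simp add: w_poly_wheel[OF n] algebra_simps)
  \<comment> \<open>Such a \<open>Q\<close> could only be the whole vertex set, which leaves no room
    for a nonempty \<open>W\<close>.\<close>
  have "w_poly (wheel n) Hub Q = 0" if "Q \<in> ?M - insert {} ?N" for Q
  proof -
    have Q: "Q = ?V" "mutual_visibility_set (wheel n) Q" using that MV by auto
    then have "{W. abs_c_visible_set (wheel n) Q W \<and> Hub \<notin> W} = {{}}"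
      by (auto simp: abs_c_visible_set_def c_visible_set_def visible_set_def)
    then show ?thesis using w_poly_wheel[OF n Q(2)] by (simp add: set_gf_def)
  qed
  moreover have "{} \<in> ?M" by (simp add: mutual_visibility_set_def visible_set_def)
  moreover have "finite ?N" using finM by simp
  ultimately have "(\<Sum>Q\<in>?M. w_poly (wheel n) Hub Q) =
      w_poly (wheel n) Hub {} + (\<Sum>Q\<in>?N. w_poly (wheel n) Hub Q)"
    using finM by (subst sum.mono_neutral_right[of ?M "insert {} ?N"]) auto
  \<comment> \<open>Here the complement of \<open>Q\<close> has all \<open>n\<close> vertices,
    whence the exponent \<open>n - 1\<close>.\<close>
  moreover have "w_poly (wheel n) Hub {} = [:1, 1:] ^ (n - 1) - 1"
    using n by (simp add: w_poly_def card_wheel)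
  moreover have "visibility_poly (wheel n) = (\<Sum>Q\<in>?M. [:0, 1:] ^ card Q)"
    using visibility_poly_eq_set_gf[OF fin] by (simp add: set_gf_def)
  ultimately show ?thesis
    unfolding visibility_poly_helm[OF n] by (simp add: w sum.distrib)
qed

end
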